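(* Let $T=(V,E)$ be a leafless directed tree with no root, let $\lambda=\{\lambda_v\}_{v\in V}$ be a sequence of positive numbers, and let $1\le q<\infty$. Assume the backward shift operator $B:\mathbf{L}^q(T,\lambda)\to\mathbf{L}^q(T,\lambda)$ is bounded. For $u\in V$ and $n\in\mathbb{N}$ let $\gamma(u,n)$ be the cardinality of $\operatorname{Chi}^n(u)$, $$\Omega(u,n):=\frac{1}{(\gamma(u,n))^q}\sum_{v\in\operatorname{Chi}^n(u)}\lambda_v,\qquad \Theta(u,n):=\big(\gamma(\operatorname{par}^n(u),n)\big)^{q-1}\lambda_{\operatorname{par}^n(u)} .$$ If there exists an increasing sequence of natural numbers $\{n_k\}$ such that for all $u\in V$ we have $$\Theta(u,n_k)\to0\quad\text{and}\quad\Omega(u,n_k)\to0$$ as $k\to\infty$, then the operator $B:\mathbf{L}^q(T,\lambda)\to\mathbf{L}^q(T,\lambda)$ is hypercyclic.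
   Context: A directed graph $T=(V,E)$ consists of a countably infinite set $V$ of vertices and a set $E\subseteq V\times V$ of directed edges; it is always assumed locally finite (every vertex has finite indegree and finite outdegree). $T$ is a directed tree if it has no directed circuits (including loops $(v,v)$), its underlying undirected graph is connected, and every vertex has indegree $0$ or $1$. A root is a vertex of indegree $0$; here there is none, so every vertex $v$ has a parent $\operatorname{par}(v)$, the unique $u$ with $(u,v)\in E$, and $\operatorname{par}^n$ denotes the $n$-fold iterate of $\operatorname{par}$. A leaf is a vertex of outdegree $0$; leafless means having no leaf. $\operatorname{Chi}(u)=\{v\in V:\operatorname{par}(v)=u\}$, and for $n\in\mathbb{N}=\{1,2,\dots\}$, $\operatorname{Chi}^n(u)=\{v\in V:\operatorname{par}^n(v)=u\}$. $\mathbf{L}^q(T,\lambda)$ is the complex Banach space of functions $f:V\to\mathbb{C}$ with $\|f\|_q=\big(\sum_{v\in V}|f(v)|^q\lambda_v\big)^{1/q}<\infty$. The backward shift $B$ is defined by $(Bf)(u)=\sum_{v\in\operatorname{Chi}(u)}f(v)$ for $u\in V$. A bounded operator $A$ on a Banach space $\mathcal{B}$ is hypercyclic if there is $x\in\mathcal{B}$ such that $\{A^nx: n=0,1,2,\dots\}$ is dense in $\mathcal{B}$. "Increasing" means strictly increasing. *)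

theory Defs
  imports "HOL-Analysis.Analysis"
begin

section \<open>Directed trees\<close>

definition indegree :: "('v \<times> 'v) set \<Rightarrow> 'v \<Rightarrow> nat" where
  "indegree E v = card {u. (u, v) \<in> E}"

definition outdegree :: "('v \<times> 'v) set \<Rightarrow> 'v \<Rightarrow> nat" where
  "outdegree E u = card {v. (u, v) \<in> E}"

text \<open>A locally finite directed graph on a countably infinite vertex set.\<close>

definition directed_graph :: "'v set \<Rightarrow> ('v \<times> 'v) set \<Rightarrow> bool" where
  "directed_graph V E \<longleftrightarrow>
     countable V \<and> infinite V \<and> E \<subseteq> V \<times> V \<and>
     (\<forall>v\<in>V. finite {u. (u, v) \<in> E} \<and> finite {w. (v, w) \<in> E})"

text \<open>\<^const>\<open>acyclic\<close> excludes all directed circuits, loops included; the second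
  condition says that the underlying undirected graph is connected.\<close>

definition directed_tree :: "'v set \<Rightarrow> ('v \<times> 'v) set \<Rightarrow> bool" where
  "directed_tree V E \<longleftrightarrow>
     directed_graph V E \<and> acyclic E \<and>
     (\<forall>u\<in>V. \<forall>v\<in>V. (u, v) \<in> (E \<union> E\<inverse>)\<^sup>*) \<and>
     (\<forall>v\<in>V. indegree E v = 0 \<or> indegree E v = 1)"

definition is_root :: "'v set \<Rightarrow> ('v \<times> 'v) set \<Rightarrow> 'v \<Rightarrow> bool" where
  "is_root V E v \<longleftrightarrow> v \<in> V \<and> indegree E v = 0"

definition is_leaf :: "'v set \<Rightarrow> ('v \<times> 'v) set \<Rightarrow> 'v \<Rightarrow> bool" where
  "is_leaf V E v \<longleftrightarrow> v \<in> V \<and> outdegree E v = 0"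

definition leafless :: "'v set \<Rightarrow> ('v \<times> 'v) set \<Rightarrow> bool" where
  "leafless V E \<longleftrightarrow> (\<forall>v. \<not> is_leaf V E v)"

definition rootless :: "'v set \<Rightarrow> ('v \<times> 'v) set \<Rightarrow> bool" where
  "rootless V E \<longleftrightarrow> (\<forall>v. \<not> is_root V E v)"

text \<open>Meaningful at every vertex of a rootless directed tree, where the parent exists and is unique.\<close>

definition par :: "('v \<times> 'v) set \<Rightarrow> 'v \<Rightarrow> 'v" where
  "par E v = (THE u. (u, v) \<in> E)"

definition Chi :: "'v set \<Rightarrow> ('v \<times> 'v) set \<Rightarrow> 'v \<Rightarrow> 'v set" where
  "Chi V E u = {v \<in> V. par E v = u}"

definition Chi_iter :: "'v set \<Rightarrow> ('v \<times> 'v) set \<Rightarrow> nat \<Rightarrow> 'v \<Rightarrow> 'v set" where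
  "Chi_iter V E n u = {v \<in> V. (par E ^^ n) v = u}"

definition \<gamma> :: "'v set \<Rightarrow> ('v \<times> 'v) set \<Rightarrow> 'v \<Rightarrow> nat \<Rightarrow> nat" where
  "\<gamma> V E u n = card (Chi_iter V E n u)"

definition \<Omega> :: "'v set \<Rightarrow> ('v \<times> 'v) set \<Rightarrow> ('v \<Rightarrow> real) \<Rightarrow> real \<Rightarrow> 'v \<Rightarrow> nat \<Rightarrow> real" where
  "\<Omega> V E lam q u n =
     1 / (real (\<gamma> V E u n) powr q) * (\<Sum>v\<in>Chi_iter V E n u. lam v)"

definition \<Theta> :: "'v set \<Rightarrow> ('v \<times> 'v) set \<Rightarrow> ('v \<Rightarrow> real) \<Rightarrow> real \<Rightarrow> 'v \<Rightarrow> nat \<Rightarrow> real" where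
  "\<Theta> V E lam q u n =
     real (\<gamma> V E ((par E ^^ n) u) n) powr (q - 1) * lam ((par E ^^ n) u)"


section \<open>Weighted \<open>L\<^sup>q\<close> spaces\<close>

text \<open>A function on \<open>V\<close> is represented by its extension by \<open>0\<close> to the whole type, so
  that elements of the space are equal iff they agree on \<open>V\<close>.\<close>

definition Lq :: "'v set \<Rightarrow> ('v \<Rightarrow> real) \<Rightarrow> real \<Rightarrow> ('v \<Rightarrow> complex) set" where
  "Lq V lam q =
     {f. (\<forall>v. v \<notin> V \<longrightarrow> f v = 0) \<and> (\<lambda>v. norm (f v) powr q * lam v) summable_on V}"

definition Lq_norm :: "'v set \<Rightarrow> ('v \<Rightarrow> real) \<Rightarrow> real \<Rightarrow> ('v \<Rightarrow> complex) \<Rightarrow> real" where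
  "Lq_norm V lam q f = (\<Sum>\<^sub>\<infinity>v\<in>V. norm (f v) powr q * lam v) powr (1 / q)"

definition Lq_dist ::
    "'v set \<Rightarrow> ('v \<Rightarrow> real) \<Rightarrow> real \<Rightarrow> ('v \<Rightarrow> complex) \<Rightarrow> ('v \<Rightarrow> complex) \<Rightarrow> real" where
  "Lq_dist V lam q f g = Lq_norm V lam q (\<lambda>v. f v - g v)"

lemma powr_convex_nonneg:
  fixes x y s t q :: real
  assumes "1 \<le> q" "0 \<le> x" "0 \<le> y" "0 < s" "0 < t" "s + t = 1"
  shows "(s * x + t * y) powr q \<le> s * x powr q + t * y powr q"
proof -
  have small: "(r * z) powr q \<le> r * z powr q" if "0 < r" "r < 1" "0 \<le> z" for r z :: real
  proof -
    have "r powr q \<le> r powr 1"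
      using that assms(1) by (intro powr_mono') auto
    then show ?thesis
      using that by (simp add: powr_mult mult_right_mono)
  qed
  consider "x = 0" | "y = 0" | "0 < x" "0 < y"
    using assms by linarith
  then show ?thesis
  proof cases
    case 3
    have "convex_on {0<..} (\<lambda>x::real. x powr q)"
      by (rule powr_convex[OF assms(1)])
    from convex_onD[OF this, of t x y]
    have "((1 - t) * x + t * y) powr q \<le> (1 - t) * x powr q + t * y powr q"
      using 3 assms by simp
    moreover have "1 - t = s" using assms by simp
    ultimately show ?thesis by simp
  qed (use small[of t y] small[of s x] assms in auto)
qed

lemma Lq_add:
  fixes f g :: "'v \<Rightarrow> complex"
  assumes lam: "\<forall>v\<in>V. lam v > 0" and q: "1 \<le> q"
    and f: "f \<in> Lq V lam q" and g: "g \<in> Lq V lam q"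
  shows "(\<lambda>v. f v + g v) \<in> Lq V lam q"
    and "Lq_norm V lam q (\<lambda>v. f v + g v) \<le> Lq_norm V lam q f + Lq_norm V lam q g"
proof -
  define F where "F = (\<lambda>(f::'v \<Rightarrow> complex) v. norm (f v) powr q * lam v)"
  have F0: "F h v \<ge> 0" if "v \<in> V" for h v
    using lam that by (simp add: F_def less_imp_le)
  have fs: "F f summable_on V" and gs: "F g summable_on V"
    using f g by (simp_all add: Lq_def F_def)
  have key: "F (\<lambda>v. f v + g v) v
      \<le> (a + b) powr q * (a / (a + b) * (F f v / a powr q) + b / (a + b) * (F g v / b powr q))"
    if ab: "0 < a" "0 < b" and v: "v \<in> V" for a b :: real and v
  proof -
    have "norm (f v + g v) powr q \<le> (norm (f v) + norm (g v)) powr q"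
      using q by (intro powr_mono2) (auto simp: norm_triangle_ineq)
    also have "norm (f v) + norm (g v)
        = (a + b) * (a / (a + b) * (norm (f v) / a) + b / (a + b) * (norm (g v) / b))"
    proof -
      have "a + b \<noteq> 0" using ab by simp
      then show ?thesis using ab by (simp add: distrib_left)
    qed
    also have "\<dots> powr q
        = (a + b) powr q * (a / (a + b) * (norm (f v) / a) + b / (a + b) * (norm (g v) / b)) powr q"
      using ab by (intro powr_mult)
    also have "\<dots> \<le> (a + b) powr q *
        (a / (a + b) * (norm (f v) / a) powr q + b / (a + b) * (norm (g v) / b) powr q)"
      using ab q by (intro mult_left_mono powr_convex_nonneg)
        (auto simp flip: add_divide_distrib)
    finally have "norm (f v + g v) powr q * lam v \<le> (a + b) powr q *
        (a / (a + b) * (norm (f v) / a) powr q + b / (a + b) * (norm (g v) / b) powr q) * lam v"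
      using lam v by (intro mult_right_mono) (auto simp: less_imp_le)
    then show ?thesis
      using ab by (simp add: F_def powr_divide algebra_simps)
  qed
  have combine: "((\<lambda>v. c * (s * (F f v * r) + t * (F g v * w)))
      has_sum c * (s * (infsum (F f) V * r) + t * (infsum (F g) V * w))) V" for c s r t w
    by (intro has_sum_cmult_right has_sum_add has_sum_cmult_left has_sum_infsum fs gs)
  have major: "(\<lambda>v. (a + b) powr q *
      (a / (a + b) * (F f v / a powr q) + b / (a + b) * (F g v / b powr q))) summable_on V"
    for a b :: real
    unfolding divide_inverse by (rule has_sum_imp_summable[OF combine])
  have fgs: "F (\<lambda>v. f v + g v) summable_on V"
    by (rule summable_on_comparison_test[OF major[of 1 1] key[of 1 1]]) (auto intro: F0)
  then show "(\<lambda>v. f v + g v) \<in> Lq V lam q"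
    using f g by (auto simp: Lq_def F_def)
  have N: "Lq_norm V lam q h = infsum (F h) V powr (1 / q)" for h
    by (simp add: Lq_norm_def F_def)
  have I0: "infsum (F h) V \<ge> 0" for h
    by (intro infsum_nonneg F0)
  have vanish: "h v = 0" if "F h summable_on V" "infsum (F h) V = 0" "v \<in> V" for h v
  proof -
    have "F h v = 0"
      using that by (intro nonneg_infsum_le_0D[OF _ that(1) F0]) simp_all
    then show ?thesis using lam that(3) by (auto simp: F_def)
  qed
  have le_sum: "Lq_norm V lam q h \<ge> 0" for h
    by (simp add: Lq_norm_def)
  consider "infsum (F f) V = 0" | "infsum (F g) V = 0"
    | "infsum (F f) V > 0" "infsum (F g) V > 0"
    using order_le_imp_less_or_eq[OF I0[of f]] order_le_imp_less_or_eq[OF I0[of g]] by metis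
  then show "Lq_norm V lam q (\<lambda>v. f v + g v) \<le> Lq_norm V lam q f + Lq_norm V lam q g"
  proof cases
    case 1
    have "F (\<lambda>v. f v + g v) v = F g v" if "v \<in> V" for v
      using vanish[OF fs 1 that] that by (simp add: F_def)
    then have "infsum (F (\<lambda>v. f v + g v)) V = infsum (F g) V"
      by (intro infsum_cong)
    then show ?thesis using le_sum[of f] by (simp add: N)
  next
    case 2
    have "F (\<lambda>v. f v + g v) v = F f v" if "v \<in> V" for v
      using vanish[OF gs 2 that] that by (simp add: F_def)
    then have "infsum (F (\<lambda>v. f v + g v)) V = infsum (F f) V"
      by (intro infsum_cong)
    then show ?thesis using le_sum[of g] by (simp add: N)
  next
    case 3
    define a where "a = Lq_norm V lam q f"
    define b where "b = Lq_norm V lam q g"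
    have ab: "0 < a" "0 < b" using 3 by (simp_all add: a_def b_def N)
    have aq: "a powr q = infsum (F f) V" and bq: "b powr q = infsum (F g) V"
      using 3 q by (simp_all add: a_def b_def N powr_powr)
    have "infsum (F (\<lambda>v. f v + g v)) V \<le> (\<Sum>\<^sub>\<infinity>v\<in>V. (a + b) powr q *
        (a / (a + b) * (F f v / a powr q) + b / (a + b) * (F g v / b powr q)))"
      by (rule infsum_mono[OF fgs major key[OF ab]])
    also have "\<dots> = (a + b) powr q * (a / (a + b) * (infsum (F f) V / a powr q)
        + b / (a + b) * (infsum (F g) V / b powr q))"
      unfolding divide_inverse by (rule infsumI[OF combine])
    also have "\<dots> = (a + b) powr q"
      using ab 3 by (simp add: aq bq flip: add_divide_distrib)
    finally have "infsum (F (\<lambda>v. f v + g v)) V powr (1 / q) \<le> ((a + b) powr q) powr (1 / q)"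
      using q by (intro powr_mono2 I0) auto
    then show ?thesis
      using ab q by (simp add: N a_def b_def powr_powr)
  qed
qed

lemma Lq_diff:
  assumes "\<forall>v\<in>V. lam v > 0" "1 \<le> q" "f \<in> Lq V lam q" "g \<in> Lq V lam q"
  shows "(\<lambda>v. f v - g v) \<in> Lq V lam q"
  using Lq_add(1)[OF assms(1-3), of "\<lambda>v. - g v"] assms(4) by (simp add: Lq_def)

lemma Metric_space_Lq:
  assumes lam: "\<forall>v\<in>V. lam v > 0" and q: "1 \<le> q"
  shows "Metric_space (Lq V lam q) (Lq_dist V lam q)"
proof
  fix f g h :: "'a \<Rightarrow> complex"
  show "0 \<le> Lq_dist V lam q f g"
    by (simp add: Lq_dist_def Lq_norm_def)
  show "Lq_dist V lam q f g = Lq_dist V lam q g f"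
    by (simp add: Lq_dist_def Lq_norm_def norm_minus_commute)
  assume f: "f \<in> Lq V lam q" and g: "g \<in> Lq V lam q"
  show "Lq_dist V lam q f g = 0 \<longleftrightarrow> f = g"
  proof
    assume 0: "Lq_dist V lam q f g = 0"
    have "f v = g v" if v: "v \<in> V" for v
    proof -
      have "norm (f v - g v) powr q * lam v = 0"
        by (rule nonneg_infsum_le_0D[of "\<lambda>v. norm (f v - g v) powr q * lam v" V])
          (use 0 v lam Lq_diff[OF lam q f g] in
            \<open>auto simp: Lq_dist_def Lq_norm_def Lq_def less_imp_le\<close>)
      then show ?thesis using lam v by auto
    qed
    moreover have "f v = g v" if "v \<notin> V" for v
      using f g that by (simp add: Lq_def)
    ultimately show "f = g" by blast
  qed (simp add: Lq_dist_def Lq_norm_def)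
  assume h: "h \<in> Lq V lam q"
  show "Lq_dist V lam q f h \<le> Lq_dist V lam q f g + Lq_dist V lam q g h"
    using Lq_add(2)[OF lam q Lq_diff[OF lam q f g] Lq_diff[OF lam q g h]]
    by (simp add: Lq_dist_def)
qed


section \<open>Operators\<close>

definition backward_shift ::
    "'v set \<Rightarrow> ('v \<times> 'v) set \<Rightarrow> ('v \<Rightarrow> complex) \<Rightarrow> ('v \<Rightarrow> complex)" where
  "backward_shift V E f u = (if u \<in> V then \<Sum>v\<in>Chi V E u. f v else 0)"

text \<open>Boundedness of a linear map \<open>A\<close> from the normed space with carrier \<open>X\<close> and norm \<open>N\<close> to itself.\<close>

definition bounded_operator_on :: "'a set \<Rightarrow> ('a \<Rightarrow> real) \<Rightarrow> ('a \<Rightarrow> 'a) \<Rightarrow> bool" where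
  "bounded_operator_on X N A \<longleftrightarrow>
     (\<forall>x\<in>X. A x \<in> X) \<and> (\<exists>C. \<forall>x\<in>X. N (A x) \<le> C * N x)"

text \<open>The orbit of \<open>x\<close>, which includes \<open>x\<close> itself (\<open>n = 0\<close>), is dense in the metric space \<open>(X, d)\<close>.\<close>

definition hypercyclic_on :: "'a set \<Rightarrow> ('a \<Rightarrow> 'a \<Rightarrow> real) \<Rightarrow> ('a \<Rightarrow> 'a) \<Rightarrow> bool" where
  "hypercyclic_on X d A \<longleftrightarrow>
     (\<exists>x\<in>X. Metric_space.mtopology X d closure_of (range (\<lambda>n. (A ^^ n) x)) = X)"

end

theory Submission
  imports Defs
begin

text \<open>
  On the finitely supported functions \<open>B\<close> satisfies the hypercyclicity criterion along \<open>(n\<^sub>k)\<close>.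
  Let \<open>e\<^sub>u\<close> be the indicator function of \<open>u\<close>. Then \<open>B\<^sup>n e\<^sub>u = e\<^sub>p\<close> with \<open>p = par\<^sup>n(u)\<close>, whose norm to the
  power \<open>q\<close> is \<open>\<lambda>\<^sub>p \<le> \<Theta>(u, n)\<close>. The operator \<open>S\<^sub>n\<close> that spreads the value at \<open>u\<close> evenly over
  \<open>Chi\<^sup>n(u)\<close> is a right inverse of \<open>B\<^sup>n\<close>, and \<open>\<parallel>S\<^sub>n e\<^sub>u\<parallel>\<^sup>q = \<Omega>(u, n)\<close>. If \<open>y\<^sub>0, y\<^sub>1, \<dots>\<close> are
  finitely supported, dense, and each repeated infinitely often, then
  \<open>x = \<Sum>\<^sub>j S\<^bsub>m\<^sub>j\<^esub> y\<^sub>j\<close> is a hypercyclic vector as soon as the \<open>m\<^sub>j\<close> are chosen inductively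
  among the \<open>n\<^sub>k\<close> so that the cross terms \<open>B\<^bsub>m\<^sub>j\<^esub> S\<^bsub>m\<^sub>i\<^esub> y\<^sub>i\<close>, \<open>i \<noteq> j\<close>, are small.
\<close>

section \<open>Weighted spaces\<close>

locale weighted_Lq =
  fixes V :: "'v set" and lam :: "'v \<Rightarrow> real" and q :: real
  assumes lam_pos: "v \<in> V \<Longrightarrow> lam v > 0"
    and q_ge_1: "1 \<le> q"
begin

abbreviation X :: "('v \<Rightarrow> complex) set" where "X \<equiv> Lq V lam q"
abbreviation N :: "('v \<Rightarrow> complex) \<Rightarrow> real" where "N \<equiv> Lq_norm V lam q"

sublocale Metric_space X "Lq_dist V lam q"
  by (rule Metric_space_Lq) (use lam_pos q_ge_1 in auto)

section \<open>Norm arithmetic and series in \<open>X\<close>\<close>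

lemma Lq_zero_outside: "f \<in> X \<Longrightarrow> v \<notin> V \<Longrightarrow> f v = 0"
  by (simp add: Lq_def)

lemma Lq_norm_nonneg: "0 \<le> N f"
  by (simp add: Lq_norm_def)

lemma Lq_norm_powr: "N f powr q = (\<Sum>\<^sub>\<infinity>v\<in>V. norm (f v) powr q * lam v)"
proof -
  have "0 \<le> (\<Sum>\<^sub>\<infinity>v\<in>V. norm (f v) powr q * lam v)"
    by (intro infsum_nonneg) (simp add: lam_pos less_imp_le)
  then show ?thesis
    using q_ge_1 by (simp add: Lq_norm_def powr_powr)
qed

lemma Lq_zero: "(\<lambda>v. 0) \<in> X" "N (\<lambda>v. 0) = 0"
  by (simp_all add: Lq_def Lq_norm_def)

lemma Lq_scale:
  assumes "f \<in> X"
  shows "(\<lambda>v. c * f v) \<in> X" "N (\<lambda>v. c * f v) = norm c * N f"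
proof -
  have eq: "norm (c * f v) powr q * lam v = norm c powr q * (norm (f v) powr q * lam v)" for v
    by (simp add: norm_mult powr_mult)
  show "(\<lambda>v. c * f v) \<in> X"
    using assms by (simp add: Lq_def eq summable_on_cmult_right)
  have "N (\<lambda>v. c * f v) = (norm c powr q * N f powr q) powr (1 / q)"
    unfolding Lq_norm_powr
    by (simp add: Lq_norm_def eq infsum_cmult_right')
  then show "N (\<lambda>v. c * f v) = norm c * N f"
    using q_ge_1 Lq_norm_nonneg[of f] by (simp add: powr_mult powr_powr)
qed

lemma Lq_plus:
  assumes "f \<in> X" "g \<in> X"
  shows "(\<lambda>v. f v + g v) \<in> X" "N (\<lambda>v. f v + g v) \<le> N f + N g"
  using Lq_add[OF _ q_ge_1 assms] lam_pos by simp_all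

lemma Lq_sum:
  assumes "finite I" "\<And>i. i \<in> I \<Longrightarrow> f i \<in> X"
  shows "(\<lambda>v. \<Sum>i\<in>I. f i v) \<in> X \<and> N (\<lambda>v. \<Sum>i\<in>I. f i v) \<le> (\<Sum>i\<in>I. N (f i))"
  using assms
proof (induction I rule: finite_induct)
  case (insert i I)
  then have "(\<lambda>v. \<Sum>i\<in>I. f i v) \<in> X" "f i \<in> X"
    by auto
  with insert show ?case
    using Lq_plus[of "f i" "\<lambda>v. \<Sum>i\<in>I. f i v"] by auto
qed (simp add: Lq_zero)

text \<open>Fatou's lemma for counting measure; it takes the place of completeness.\<close>

lemma Lq_sums:
  assumes f: "\<And>j. f j \<in> X" and le: "\<And>j. N (f j) \<le> a j" and a: "summable a"
    and g: "\<And>v. (\<lambda>j. f j v) sums g v"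
  shows "g \<in> X" "N g \<le> suminf a"
proof -
  define A where "A = suminf a"
  have a0: "0 \<le> a j" for j
    using Lq_norm_nonneg le order_trans by blast
  have A0: "0 \<le> A"
    unfolding A_def by (intro suminf_nonneg a a0)
  \<comment> \<open>For fixed finite \<open>F\<close>, Minkowski bounds every partial sum by
    \<open>A\<close>, and the bound survives the coordinatewise limit. It is uniform in
    \<open>F\<close>, which gives both summability and the norm estimate.\<close>
  have fin: "(\<Sum>v\<in>F. norm (g v) powr q * lam v) \<le> A powr q" if F: "finite F" "F \<subseteq> V" for F
  proof (rule LIMSEQ_le_const2)
    show "(\<lambda>n. \<Sum>v\<in>F. norm (\<Sum>j<n. f j v) powr q * lam v)
        \<longlonglongrightarrow> (\<Sum>v\<in>F. norm (g v) powr q * lam v)"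
      using g q_ge_1 unfolding sums_def
      by (intro tendsto_sum tendsto_mult tendsto_powr' tendsto_norm tendsto_const) auto
    have "(\<Sum>v\<in>F. norm (\<Sum>j<n. f j v) powr q * lam v) \<le> A powr q" for n
    proof -
      have s: "(\<lambda>v. \<Sum>j<n. f j v) \<in> X" "N (\<lambda>v. \<Sum>j<n. f j v) \<le> (\<Sum>j<n. N (f j))"
        using Lq_sum[of "{..<n}" f] f by auto
      have "(\<Sum>j<n. N (f j)) \<le> (\<Sum>j<n. a j)"
        by (intro sum_mono le)
      also have "\<dots> \<le> A"
        unfolding A_def by (intro sum_le_suminf a a0) auto
      finally have sA: "N (\<lambda>v. \<Sum>j<n. f j v) \<le> A"
        using s by linarith
      have "(\<Sum>v\<in>F. norm (\<Sum>j<n. f j v) powr q * lam v)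
          \<le> (\<Sum>\<^sub>\<infinity>v\<in>V. norm (\<Sum>j<n. f j v) powr q * lam v)"
        using s(1) F lam_pos
        by (intro finite_sum_le_infsum) (auto simp: Lq_def less_imp_le)
      also have "\<dots> \<le> A powr q"
        unfolding Lq_norm_powr[symmetric]
        using sA q_ge_1 Lq_norm_nonneg by (intro powr_mono2) auto
      finally show ?thesis .
    qed
    then show "\<exists>M. \<forall>n\<ge>M. (\<Sum>v\<in>F. norm (\<Sum>j<n. f j v) powr q * lam v) \<le> A powr q"
      by blast
  qed
  have sm: "(\<lambda>v. norm (g v) powr q * lam v) summable_on V"
    using fin lam_pos
    by (intro nonneg_bdd_above_summable_on bdd_aboveI2[where M = "A powr q"])
      (auto simp: less_imp_le)
  have "g v = 0" if "v \<notin> V" for v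
    using g[of v] f that by (auto simp: Lq_zero_outside intro: sums_unique2[OF _ sums_zero])
  with sm show "g \<in> X"
    by (simp add: Lq_def)
  have "N g powr q \<le> A powr q"
    unfolding Lq_norm_powr using sm fin by (intro infsum_le_finite_sums)
  then show "N g \<le> suminf a"
    using A0 Lq_norm_nonneg[of g] q_ge_1 unfolding A_def[symmetric]
    by (metis not_le powr_less_mono2 zero_less_one less_le_trans)
qed

text \<open>Evaluation at a vertex is continuous: a single term of the norm sum bounds the
  coordinate by \<open>N (f j)\<close> divided by the q-th root of the weight. This supplies the
  pointwise limit that \<open>Lq_sums\<close> requires.\<close>

lemma Lq_summable_pointwise:
  assumes f: "\<And>j. f j \<in> X" and s: "summable (\<lambda>j. N (f j))"
  shows "summable (\<lambda>j. f j v)"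
proof (cases "v \<in> V")
  case True
  define c where "c = lam v powr (1 / q)"
  have c: "c > 0"
    using lam_pos[OF True] by (simp add: c_def)
  have "norm (f j v) \<le> N (f j) / c" for j
  proof -
    have "(\<Sum>v\<in>{v}. norm (f j v) powr q * lam v)
        \<le> (\<Sum>\<^sub>\<infinity>v\<in>V. norm (f j v) powr q * lam v)"
      using f[of j] True lam_pos
      by (intro finite_sum_le_infsum) (auto simp: Lq_def less_imp_le)
    then have "(norm (f j v) powr q * lam v) powr (1 / q) \<le> (N (f j) powr q) powr (1 / q)"
      unfolding Lq_norm_powr
      using q_ge_1 lam_pos[OF True] by (intro powr_mono2) auto
    then show ?thesis
      using q_ge_1 Lq_norm_nonneg[of "f j"] c
      by (simp add: powr_mult powr_powr c_def field_simps)
  qed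
  then show ?thesis
    by (intro summable_comparison_test'[OF summable_divide[OF s]])
qed (simp add: Lq_zero_outside[OF f])

lemma Lq_finite_support:
  assumes "finite F" "F \<subseteq> V" "\<And>v. v \<notin> F \<Longrightarrow> f v = 0"
  shows "f \<in> X" "N f = (\<Sum>v\<in>F. norm (f v) powr q * lam v) powr (1 / q)"
proof -
  have "((\<lambda>v. norm (f v) powr q * lam v) has_sum (\<Sum>v\<in>F. norm (f v) powr q * lam v)) V"
    using assms by (intro has_sum_finite_neutralI) auto
  then show "f \<in> X" "N f = (\<Sum>v\<in>F. norm (f v) powr q * lam v) powr (1 / q)"
    using assms by (auto simp: Lq_def Lq_norm_def has_sum_imp_summable infsumI)
qed

text \<open>By linearity this reduces limits for finitely supported functions to limits for single
  indicator functions.\<close>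

lemma Lq_norm_combination_tendsto_0:
  assumes "finite F" and g: "\<And>k u. u \<in> F \<Longrightarrow> g k u \<in> X"
    and lim: "\<And>u. u \<in> F \<Longrightarrow> (\<lambda>k. N (g k u)) \<longlonglongrightarrow> 0"
  shows "(\<lambda>k. N (\<lambda>v. \<Sum>u\<in>F. c u * g k u v)) \<longlonglongrightarrow> 0"
proof (rule tendsto_sandwich[where f = "\<lambda>_. 0"])
  have "N (\<lambda>v. \<Sum>u\<in>F. c u * g k u v) \<le> (\<Sum>u\<in>F. norm (c u) * N (g k u))" for k
  proof -
    have "N (\<lambda>v. \<Sum>u\<in>F. c u * g k u v) \<le> (\<Sum>u\<in>F. N (\<lambda>v. c u * g k u v))"
      using Lq_sum[OF \<open>finite F\<close>, of "\<lambda>u v. c u * g k u v"] g Lq_scale(1) by blast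
    also have "\<dots> = (\<Sum>u\<in>F. norm (c u) * N (g k u))"
      by (intro sum.cong refl Lq_scale(2) g)
    finally show ?thesis .
  qed
  then show "\<forall>\<^sub>F k in sequentially. N (\<lambda>v. \<Sum>u\<in>F. c u * g k u v)
      \<le> (\<Sum>u\<in>F. norm (c u) * N (g k u))"
    by simp
  show "(\<lambda>k. \<Sum>u\<in>F. norm (c u) * N (g k u)) \<longlonglongrightarrow> 0"
    by (intro tendsto_null_sum tendsto_mult_right_zero lim)
qed (auto simp: Lq_norm_nonneg)

text \<open>Functions with finite support and values in a countable dense set of scalars are coded
  by finite lists, hence countable. They approximate any \<open>f\<close>: truncate it to a finite
  set, then perturb the values.\<close>

lemma Lq_separable:
  assumes "countable V"
  obtains y :: "nat \<Rightarrow> 'v \<Rightarrow> complex"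
  where "\<And>j. finite {v. y j v \<noteq> 0}" "\<And>j. {v. y j v \<noteq> 0} \<subseteq> V"
    "\<And>f r. f \<in> X \<Longrightarrow> r > 0 \<Longrightarrow> \<exists>j. N (\<lambda>v. f v - y j v) < r"
proof -
  obtain Q :: "complex set" where Q: "countable Q"
    and dense: "\<And>U. open U \<Longrightarrow> U \<noteq> {} \<Longrightarrow> \<exists>d\<in>Q. d \<in> U"
    by (rule countable_dense_setE) blast
  \<comment> \<open>An association list is read as a function, with value 0 at vertices that are not
    keys.\<close>
  define step where "step xs v = (case map_of xs v of None \<Rightarrow> 0 | Some c \<Rightarrow> c)"
    for xs :: "('v \<times> complex) list" and v
  define y where "y = (\<lambda>j. step (from_nat_into (lists (V \<times> Q)) j))"
  have ne: "lists (V \<times> Q) \<noteq> {}" and ct: "countable (lists (V \<times> Q))"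
    using assms Q by auto
  have supp: "{v. step xs v \<noteq> 0} \<subseteq> fst ` set xs" for xs
    by (auto simp: step_def split: option.splits dest: map_of_SomeD intro: rev_image_eqI)
  show thesis
  proof
    show "finite {v. y j v \<noteq> 0}" for j
      using supp finite_subset unfolding y_def by blast
    show "{v. y j v \<noteq> 0} \<subseteq> V" for j
      using supp[of "from_nat_into (lists (V \<times> Q)) j"] from_nat_into[OF ne, of j]
      unfolding y_def by fastforce
    fix f :: "'v \<Rightarrow> complex" and r :: real
    assume f: "f \<in> X" and r: "r > 0"
    let ?w = "\<lambda>h v. norm (h v :: complex) powr q * lam v"
    \<comment> \<open>The target is a q-th power of the error below \<open>r powr q\<close>, that is
      \<open>2 * d\<close>: the tail off \<open>F\<close> costs at most \<open>d / 2\<close>, the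
      values on \<open>F\<close> less than \<open>d\<close>.\<close>
    define d where "d = r powr q / 2"
    have d: "d > 0" using r by (simp add: d_def)
    have fs: "?w f summable_on V" using f by (simp add: Lq_def)
    obtain F where F: "finite F" "F \<subseteq> V" "dist (sum (?w f) F) (infsum (?w f) V) \<le> d / 2"
      using infsum_finite_approximation[OF fs, of "d / 2"] d by auto
    \<comment> \<open>The error is continuous in \<open>c\<close> and vanishes at
      \<open>f v\<close>. The summand 1 in \<open>1 + card F\<close> keeps the total over
      \<open>F\<close> strictly below \<open>d\<close>, also for empty \<open>F\<close>.\<close>
    have "\<exists>c\<in>Q. norm (f v - c) powr q * lam v < d / (1 + card F)" if "v \<in> F" for v
    proof -
      have "isCont (\<lambda>c. norm (f v - c) powr q * lam v) (f v)"
        using q_ge_1 unfolding isCont_def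
        by (intro tendsto_mult tendsto_powr' tendsto_intros) auto
      then have "(\<lambda>c. norm (f v - c) powr q * lam v) \<midarrow>f v\<rightarrow> 0"
        using q_ge_1 by (simp add: isCont_def)
      then have "\<forall>\<^sub>F c in at (f v). norm (f v - c) powr q * lam v < d / (1 + card F)"
        using d by (intro order_tendstoD) auto
      then obtain S where S: "open S" "f v \<in> S"
        "\<And>c. c \<in> S \<Longrightarrow> c \<noteq> f v \<Longrightarrow> norm (f v - c) powr q * lam v < d / (1 + card F)"
        unfolding eventually_at_topological by blast
      obtain c where "c \<in> Q" "c \<in> S" using dense[OF S(1)] S(2) by blast
      \<comment> \<open>The limit says nothing about the centre \<open>c = f v\<close>, which may
        itself lie in \<open>Q\<close>.\<close>
      moreover have "norm (f v - f v) powr q * lam v < d / (1 + card F)"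
        using d by simp
      ultimately show ?thesis using S(3) by metis
    qed
    then obtain c where c: "\<And>v. v \<in> F \<Longrightarrow> c v \<in> Q"
      "\<And>v. v \<in> F \<Longrightarrow> norm (f v - c v) powr q * lam v < d / (1 + card F)"
      by metis
    obtain vs where vs: "set vs = F" using finite_list[OF F(1)] by blast
    define xs where "xs = map (\<lambda>v. (v, c v)) vs"
    have step: "step xs v = (if v \<in> F then c v else 0)" for v
      using vs by (simp add: xs_def step_def map_of_map_restrict restrict_map_def)
    have "xs \<in> lists (V \<times> Q)"
      using vs c F(2) by (auto simp: xs_def)
    then obtain j where j: "y j = step xs"
      unfolding y_def using from_nat_into_surj[OF ct] by metis
    define h where "h = (\<lambda>v. f v - y j v)"
    \<comment> \<open>Off \<open>F\<close> the error \<open>h\<close> equals \<open>f\<close>, so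
      its sum there is the tail of \<open>f\<close>.\<close>
    have "(?w f has_sum (infsum (?w f) V - sum (?w f) F)) (V - F)"
      using F by (intro has_sum_Diff has_sum_infsum fs) auto
    then have 1: "(?w h has_sum (infsum (?w f) V - sum (?w f) F)) (V - F)"
      by (rule has_sum_cong[THEN iffD1, rotated]) (simp add: h_def j step)
    have "(?w h has_sum (infsum (?w f) V - sum (?w f) F + sum (?w h) F)) ((V - F) \<union> F)"
      using F by (intro has_sum_Un_disjoint 1) auto
    then have "infsum (?w h) V = infsum (?w f) V - sum (?w f) F + sum (?w h) F"
      using F by (simp add: infsumI Un_absorb2)
    moreover have "sum (?w h) F \<le> (\<Sum>v\<in>F. d / (1 + card F))"
      by (intro sum_mono) (use c(2) in \<open>auto simp: h_def j step less_imp_le\<close>)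
    moreover have "(\<Sum>v\<in>F. d / (1 + card F)) < d"
      using d by (simp add: field_simps)
    moreover have "d / 2 < d" using d by simp
    ultimately have "infsum (?w h) V < 2 * d"
      using F(3) unfolding dist_real_def by linarith
    then have "N h powr q < r powr q"
      unfolding Lq_norm_powr by (simp add: d_def)
    then have "N h < r"
      using powr_mono2[of q r "N h"] q_ge_1 r by (meson not_le less_imp_le order_trans zero_le_one)
    then show "\<exists>j. N (\<lambda>v. f v - y j v) < r"
      unfolding h_def by blast
  qed
qed

end

section \<open>Iterates of the backward shift\<close>

locale leafless_rootless_tree =
  fixes V :: "'v set" and E :: "('v \<times> 'v) set"
  assumes tree: "directed_tree V E" and leafless: "leafless V E" and rootless: "rootless V E"
begin

section \<open>Parents, children and later generations\<close>

lemma graph: "directed_graph V E"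
  using tree by (simp add: directed_tree_def)

text \<open>Having no root excludes indegree 0, so the indegree is 1 and the description defining
  \<open>par\<close> denotes the only predecessor.\<close>

lemma par_edge:
  assumes "v \<in> V"
  shows "(u, v) \<in> E \<longleftrightarrow> u = par E v"
proof -
  have "indegree E v = 1"
    using assms tree rootless unfolding directed_tree_def rootless_def is_root_def by blast
  then obtain p where p: "{u. (u, v) \<in> E} = {p}"
    unfolding indegree_def using card_1_singletonE by blast
  then have "par E v = p"
    unfolding par_def by (intro the_equality) auto
  with p show ?thesis by auto
qed

lemma par_in_V: "v \<in> V \<Longrightarrow> par E v \<in> V"
  using par_edge[of v "par E v"] graph by (auto simp: directed_graph_def)

lemma par_iter_in_V: "v \<in> V \<Longrightarrow> (par E ^^ n) v \<in> V"
  by (induction n) (auto intro: par_in_V)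

lemma Chi_eq: "Chi V E u = {v. (u, v) \<in> E}"
  using par_edge graph by (auto simp: Chi_def directed_graph_def)

lemma finite_Chi: "u \<in> V \<Longrightarrow> finite (Chi V E u)"
  using graph by (simp add: Chi_eq directed_graph_def)

lemma Chi_nonempty:
  assumes "u \<in> V"
  shows "Chi V E u \<noteq> {}"
proof -
  have "outdegree E u \<noteq> 0"
    using assms leafless by (simp add: leafless_def is_leaf_def)
  then show ?thesis
    by (intro notI) (simp add: outdegree_def Chi_eq)
qed

lemma Chi_subset: "Chi V E u \<subseteq> V"
  by (auto simp: Chi_def)

lemma Chi_iter_0: "u \<in> V \<Longrightarrow> Chi_iter V E 0 u = {u}"
  by (auto simp: Chi_iter_def)

lemma Chi_iter_Suc: "Chi_iter V E (Suc n) u = (\<Union>w\<in>Chi V E u. Chi_iter V E n w)"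
  by (auto simp: Chi_iter_def Chi_def par_iter_in_V)

lemma finite_Chi_iter: "u \<in> V \<Longrightarrow> finite (Chi_iter V E n u)"
proof (induction n arbitrary: u)
  case (Suc n)
  then show ?case
    using Chi_subset finite_Chi by (auto simp: Chi_iter_Suc)
qed (simp add: Chi_iter_0)

lemma Chi_iter_nonempty: "u \<in> V \<Longrightarrow> Chi_iter V E n u \<noteq> {}"
proof (induction n arbitrary: u)
  case (Suc n)
  then obtain w where "w \<in> Chi V E u" "w \<in> V"
    using Chi_nonempty Chi_subset by blast
  with Suc.IH[of w] show ?case
    by (auto simp: Chi_iter_Suc)
qed (simp add: Chi_iter_0)

lemma gamma_pos: "u \<in> V \<Longrightarrow> \<gamma> V E u n > 0"
  by (simp add: \<gamma>_def card_gt_0_iff finite_Chi_iter Chi_iter_nonempty)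

text \<open>Induction on \<open>n\<close>: the sets of n-th descendants of distinct children are
  disjoint, because \<open>par\<close> is a function, so the double sum becomes one sum. At
  \<open>n = 0\<close> the value off \<open>V\<close> is that of \<open>f\<close> itself, hence the
  assumption.\<close>

lemma backward_shift_iter:
  assumes "\<And>v. v \<notin> V \<Longrightarrow> f v = 0"
  shows "(backward_shift V E ^^ n) f u = (if u \<in> V then \<Sum>v\<in>Chi_iter V E n u. f v else 0)"
proof (induction n arbitrary: u)
  case (Suc n)
  have "(backward_shift V E ^^ Suc n) f u = (\<Sum>v\<in>Chi_iter V E (Suc n) u. f v)" if "u \<in> V"
  proof -
    have "(backward_shift V E ^^ Suc n) f u = (\<Sum>w\<in>Chi V E u. \<Sum>v\<in>Chi_iter V E n w. f v)"
      unfolding funpow.simps comp_def backward_shift_def[of V E "(backward_shift V E ^^ n) f"]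
      using Suc that by (auto simp: subsetD[OF Chi_subset] intro!: sum.cong)
    also have "\<dots> = (\<Sum>v\<in>Chi_iter V E (Suc n) u. f v)"
      unfolding Chi_iter_Suc using that
      by (intro sum.UNION_disjoint[symmetric] ballI)
        (auto intro: finite_Chi finite_Chi_iter subsetD[OF Chi_subset], auto simp: Chi_iter_def)
    finally show ?thesis .
  qed
  moreover have "(backward_shift V E ^^ Suc n) f u = 0" if "u \<notin> V"
    using that by (simp add: backward_shift_def[of V E "(backward_shift V E ^^ n) f"])
  ultimately show ?case by simp
qed (use assms in \<open>simp add: Chi_iter_0\<close>)

section \<open>Right inverses of the iterates\<close>

definition spread :: "nat \<Rightarrow> ('v \<Rightarrow> complex) \<Rightarrow> 'v \<Rightarrow> complex" where
  "spread n f v =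
     (if v \<in> V then f ((par E ^^ n) v) / of_nat (\<gamma> V E ((par E ^^ n) v) n) else 0)"

lemma backward_shift_spread:
  assumes "\<And>v. v \<notin> V \<Longrightarrow> f v = 0"
  shows "(backward_shift V E ^^ n) (spread n f) = f"
proof
  fix u
  show "(backward_shift V E ^^ n) (spread n f) u = f u"
  proof (cases "u \<in> V")
    case True
    have "(\<Sum>v\<in>Chi_iter V E n u. spread n f v)
        = (\<Sum>v\<in>Chi_iter V E n u. f u / of_nat (\<gamma> V E u n))"
      by (intro sum.cong) (auto simp: spread_def Chi_iter_def)
    also have "\<dots> = f u"
      using gamma_pos[OF True, of n] by (simp add: \<gamma>_def)
    finally show ?thesis
      using True by (simp add: backward_shift_iter spread_def)
  qed (use assms in \<open>simp add: backward_shift_iter spread_def\<close>)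
qed

lemma finite_support_spread:
  assumes "finite {v. f v \<noteq> 0}" "{v. f v \<noteq> 0} \<subseteq> V"
  shows "finite {v. spread n f v \<noteq> 0}" "{v. spread n f v \<noteq> 0} \<subseteq> V"
proof -
  have "{v. spread n f v \<noteq> 0} \<subseteq> (\<Union>u\<in>{v. f v \<noteq> 0}. Chi_iter V E n u)"
    by (auto simp: spread_def Chi_iter_def)
  then show "finite {v. spread n f v \<noteq> 0}"
    by (rule finite_subset) (use assms finite_Chi_iter in auto)
qed (auto simp: spread_def)

end

section \<open>The hypercyclicity criterion\<close>

locale bounded_shift = leafless_rootless_tree V E + weighted_Lq V lam q
  for V :: "'v set" and E :: "('v \<times> 'v) set" and lam :: "'v \<Rightarrow> real" and q :: real +
  fixes n :: "nat \<Rightarrow> nat"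
  assumes bounded: "bounded_operator_on X N (backward_shift V E)"
    and Theta_lim: "u \<in> V \<Longrightarrow> (\<lambda>k. \<Theta> V E lam q u (n k)) \<longlonglongrightarrow> 0"
    and Omega_lim: "u \<in> V \<Longrightarrow> (\<lambda>k. \<Omega> V E lam q u (n k)) \<longlonglongrightarrow> 0"
begin

abbreviation B :: "('v \<Rightarrow> complex) \<Rightarrow> 'v \<Rightarrow> complex" where "B \<equiv> backward_shift V E"

text \<open>The constant in \<open>bounded_operator_on\<close> may be negative; its absolute value
  can safely be raised to powers.\<close>

lemma B_iter_bounded:
  obtains C where "C \<ge> 0" "\<And>f. f \<in> X \<Longrightarrow> (B ^^ m) f \<in> X \<and> N ((B ^^ m) f) \<le> C * N f"
proof -
  obtain C0 where BX: "\<And>f. f \<in> X \<Longrightarrow> B f \<in> X" and C0: "\<And>f. f \<in> X \<Longrightarrow> N (B f) \<le> C0 * N f"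
    using bounded by (auto simp: bounded_operator_on_def)
  have C: "N (B f) \<le> \<bar>C0\<bar> * N f" if "f \<in> X" for f
    using C0[OF that] mult_right_mono[OF abs_ge_self Lq_norm_nonneg] order_trans by blast
  have "(B ^^ m) f \<in> X \<and> N ((B ^^ m) f) \<le> \<bar>C0\<bar> ^ m * N f" if "f \<in> X" for f
  proof (induction m)
    case (Suc m)
    then have "N (B ((B ^^ m) f)) \<le> \<bar>C0\<bar> * (\<bar>C0\<bar> ^ m * N f)"
      using C[of "(B ^^ m) f"] by (meson abs_ge_zero mult_left_mono order_trans)
    with Suc BX show ?case by (simp add: mult.assoc)
  qed (simp add: that)
  then show thesis using that[of "\<bar>C0\<bar> ^ m"] by simp
qed

lemma B_iter_in_Lq: "f \<in> X \<Longrightarrow> (B ^^ m) f \<in> X"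
  by (metis B_iter_bounded)

lemma norm_B_iter_tendsto_0:
  assumes fin: "finite {v. f v \<noteq> 0}" and sub: "{v. f v \<noteq> 0} \<subseteq> V"
  shows "(\<lambda>k. N ((B ^^ n k) f)) \<longlonglongrightarrow> 0"
proof -
  define F where "F = {v. f v \<noteq> 0}"
  \<comment> \<open>\<open>g k u\<close> is the image of the indicator of \<open>u\<close> under
    \<open>B ^^ n k\<close>.\<close>
  define g :: "nat \<Rightarrow> 'v \<Rightarrow> 'v \<Rightarrow> complex"
    where "g = (\<lambda>k u w. of_bool (w = (par E ^^ n k) u))"
  have g: "g k u \<in> X" "N (g k u) = lam ((par E ^^ n k) u) powr (1 / q)" if "u \<in> V" for k u
    using Lq_finite_support[of "{(par E ^^ n k) u}" "g k u"] par_iter_in_V[OF that]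
    by (auto simp: g_def)
  have "(\<lambda>k. N (\<lambda>w. \<Sum>u\<in>F. f u * g k u w)) \<longlonglongrightarrow> 0"
  proof (rule Lq_norm_combination_tendsto_0)
    fix u assume "u \<in> F"
    then have u: "u \<in> V" using sub by (auto simp: F_def)
    \<comment> \<open>The generation is nonempty, so \<open>\<gamma>\<close> is at least 1, and so
      is its power with exponent \<open>q - 1\<close>.\<close>
    have "lam ((par E ^^ n k) u) \<le> \<Theta> V E lam q u (n k)" for k
    proof -
      let ?p = "(par E ^^ n k) u"
      have "1 \<le> real (\<gamma> V E ?p (n k)) powr (q - 1)"
        using gamma_pos[OF par_iter_in_V[OF u], of "n k" "n k"] q_ge_1
        by (intro ge_one_powr_ge_zero) auto
      then show ?thesis
        using mult_right_mono[of 1 _ "lam ?p"] lam_pos[OF par_iter_in_V[OF u, of "n k"]]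
        by (simp add: \<Theta>_def)
    qed
    then have "(\<lambda>k. lam ((par E ^^ n k) u)) \<longlonglongrightarrow> 0"
      using lam_pos[OF par_iter_in_V[OF u]]
      by (intro tendsto_sandwich[OF _ _ tendsto_const Theta_lim[OF u]])
        (auto simp: less_imp_le)
    then have "(\<lambda>k. lam ((par E ^^ n k) u) powr (1 / q)) \<longlonglongrightarrow> 0 powr (1 / q)"
      using q_ge_1 lam_pos[OF par_iter_in_V[OF u]]
      by (intro tendsto_powr') (auto simp: less_imp_le)
    then show "(\<lambda>k. N (g k u)) \<longlonglongrightarrow> 0"
      by (simp add: g u)
  qed (use fin sub g in \<open>auto simp: F_def\<close>)
  moreover have "(B ^^ n k) f = (\<lambda>w. \<Sum>u\<in>F. f u * g k u w)" for k
  proof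
    fix w
    have out: "f v = 0" if "v \<notin> V" for v using that sub by auto
    \<comment> \<open>A term survives exactly when \<open>w\<close> is the ancestor of
      \<open>u\<close> of order \<open>n k\<close>.\<close>
    have "(\<Sum>u\<in>F. f u * g k u w) = (\<Sum>u\<in>F \<inter> Chi_iter V E (n k) w. f u)"
      using fin sub unfolding F_def
      by (intro sum.mono_neutral_cong_right) (auto simp: g_def Chi_iter_def)
    also have "\<dots> = (if w \<in> V then \<Sum>v\<in>Chi_iter V E (n k) w. f v else 0)"
    proof (cases "w \<in> V")
      case True
      then show ?thesis
        using finite_Chi_iter[OF True] by (auto simp: F_def intro!: sum.mono_neutral_left)
    next
      case False
      then have "Chi_iter V E (n k) w = {}"
        using par_iter_in_V by (auto simp: Chi_iter_def)
      with False show ?thesis by simp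
    qed
    finally show "(B ^^ n k) f w = (\<Sum>u\<in>F. f u * g k u w)"
      by (simp add: backward_shift_iter out)
  qed
  ultimately show ?thesis by simp
qed

lemma norm_spread_tendsto_0:
  assumes fin: "finite {v. f v \<noteq> 0}" and sub: "{v. f v \<noteq> 0} \<subseteq> V"
  shows "(\<lambda>k. N (spread (n k) f)) \<longlonglongrightarrow> 0"
proof -
  define F where "F = {v. f v \<noteq> 0}"
  define g :: "nat \<Rightarrow> 'v \<Rightarrow> 'v \<Rightarrow> complex"
    where "g = (\<lambda>k u. spread (n k) (\<lambda>w. of_bool (w = u)))"
  have g: "g k u \<in> X" "N (g k u) = \<Omega> V E lam q u (n k) powr (1 / q)" if u: "u \<in> V" for k u
  proof -
    let ?C = "Chi_iter V E (n k) u"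
    have C: "finite ?C" "?C \<subseteq> V" "\<And>v. v \<notin> ?C \<Longrightarrow> g k u v = 0"
      using finite_Chi_iter[OF u] by (auto simp: g_def spread_def Chi_iter_def)
    show "g k u \<in> X" by (rule Lq_finite_support[OF C])
    \<comment> \<open>All \<open>\<gamma>\<close> descendants carry the same value
      \<open>1 / \<gamma>\<close>, so the norm sum is \<open>\<Omega>\<close>.\<close>
    have "norm (g k u v) powr q * lam v = 1 / real (\<gamma> V E u (n k)) powr q * lam v" if "v \<in> ?C" for v
      using that by (auto simp: g_def spread_def Chi_iter_def norm_divide powr_divide)
    then show "N (g k u) = \<Omega> V E lam q u (n k) powr (1 / q)"
      by (simp add: Lq_finite_support(2)[OF C] \<Omega>_def sum_distrib_left)
  qed
  have "(\<lambda>k. N (\<lambda>w. \<Sum>u\<in>F. f u * g k u w)) \<longlonglongrightarrow> 0"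
  proof (rule Lq_norm_combination_tendsto_0)
    fix u assume "u \<in> F"
    then have u: "u \<in> V" using sub by (auto simp: F_def)
    have "0 \<le> \<Omega> V E lam q u m" for m
      unfolding \<Omega>_def using lam_pos
      by (intro mult_nonneg_nonneg sum_nonneg) (auto simp: Chi_iter_def less_imp_le)
    then have "(\<lambda>k. \<Omega> V E lam q u (n k) powr (1 / q)) \<longlonglongrightarrow> 0 powr (1 / q)"
      using q_ge_1 by (intro tendsto_powr' Omega_lim u) auto
    then show "(\<lambda>k. N (g k u)) \<longlonglongrightarrow> 0"
      by (simp add: g u)
  qed (use fin sub g in \<open>auto simp: F_def\<close>)
  moreover have "spread (n k) f = (\<lambda>w. \<Sum>u\<in>F. f u * g k u w)" for k
  proof
    fix w
    \<comment> \<open>Only the ancestor of \<open>w\<close> of order \<open>n k\<close>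
      contributes.\<close>
    have "(\<Sum>u\<in>F. f u * g k u w)
        = (\<Sum>u\<in>F. if (par E ^^ n k) w = u then spread (n k) f w else 0)"
      by (intro sum.cong) (auto simp: g_def spread_def)
    also have "\<dots> = spread (n k) f w"
      using fin by (auto simp: F_def spread_def)
    finally show "spread (n k) f w = (\<Sum>u\<in>F. f u * g k u w)" ..
  qed
  ultimately show ?thesis by simp
qed

section \<open>Construction of the hypercyclic vector\<close>

lemma hypercyclic_on_Lq: "hypercyclic_on X (Lq_dist V lam q) B"
proof -
  have "countable V"
    using graph by (simp add: directed_graph_def)
  then obtain y0 :: "nat \<Rightarrow> 'v \<Rightarrow> complex" 
    where y0: "\<And>j. finite {v. y0 j v \<noteq> 0}" "\<And>j. {v. y0 j v \<noteq> 0} \<subseteq> V"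
    and y0_dense: "\<And>f r. f \<in> X \<Longrightarrow> r > 0 \<Longrightarrow> \<exists>j. N (\<lambda>v. f v - y0 j v) < r"
    by (rule Lq_separable) blast
  \<comment> \<open>The first component of the pairing takes each value infinitely often, so each
    \<open>y0 i\<close> recurs at arbitrarily late indices.\<close>
  define y where "y j = y0 (fst (prod_decode j))" for j
  have y: "finite {v. y j v \<noteq> 0}" "{v. y j v \<noteq> 0} \<subseteq> V" for j
    using y0 by (simp_all add: y_def)
  have y_out: "y j v = 0" if "v \<notin> V" for j v
    using y(2) that by blast
  define S where "S k j = spread (n k) (y j)" for k j
  have S: "finite {v. S k j v \<noteq> 0}" "{v. S k j v \<noteq> 0} \<subseteq> V" for k j
    unfolding S_def by (intro finite_support_spread y)+
  have yX: "y j \<in> X" and SX: "S k j \<in> X" for k j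
    by (rule Lq_finite_support(1)[OF y], simp) (rule Lq_finite_support(1)[OF S], simp)
  \<comment> \<open>\<open>P m j k\<close> admits \<open>k\<close> as the choice at stage
    \<open>j\<close>: the new summand is small, also after the earlier iterates, and the new iterate
    makes the earlier summands small. It consults \<open>m\<close> only below \<open>j\<close>, as
    well-founded choice demands.\<close>
  define P where "P = (\<lambda>m j k. N (S k j) < (1/4) ^ j \<and>
      (\<forall>i\<in>{..<j}. N ((B ^^ n (m i)) (S k j)) < (1/4) ^ j \<and> N ((B ^^ n k) (S (m i) i)) < (1/4) ^ j))"
  have "\<exists>m. \<forall>j. P m j (m j)"
  proof (rule dependent_wf_choice[OF wf_less])
    fix j and m m' :: "nat \<Rightarrow> nat" and k
    assume "\<And>i. (i, j) \<in> {(x, y). x < y} \<Longrightarrow> m i = m' i"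
    then show "P m j k = P m' j k"
      unfolding P_def by auto
  next
    fix j and m :: "nat \<Rightarrow> nat"
    have ev: "\<forall>\<^sub>F k in sequentially. h k < (1/4) ^ j" if "h \<longlonglongrightarrow> 0" for h :: "nat \<Rightarrow> real"
      using that by (rule order_tendstoD) simp
    have S_lim: "(\<lambda>k. N (S k j)) \<longlonglongrightarrow> 0"
      unfolding S_def by (intro norm_spread_tendsto_0 y)
    \<comment> \<open>The exponent \<open>p\<close> stays fixed while \<open>k\<close> grows, so
      boundedness of \<open>B ^^ p\<close> transfers \<open>S_lim\<close>.\<close>
    have BS_lim: "(\<lambda>k. N ((B ^^ p) (S k j))) \<longlonglongrightarrow> 0" for p
    proof -
      obtain C where "C \<ge> 0" and C: "\<And>f. f \<in> X \<Longrightarrow> (B ^^ p) f \<in> X \<and> N ((B ^^ p) f) \<le> C * N f"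
        using B_iter_bounded[of p] by blast
      show ?thesis
        by (rule tendsto_sandwich[OF _ _ tendsto_const tendsto_mult_right_zero[OF S_lim, of C]])
          (use C SX Lq_norm_nonneg in auto)
    qed
    \<comment> \<open>Finitely many conditions, each eventually true: \<open>BS_lim\<close> serves
      the earlier iterates, \<open>norm_B_iter_tendsto_0\<close> the earlier summands, which are
      fixed and finitely supported.\<close>
    have "\<forall>\<^sub>F k in sequentially. P m j k"
      unfolding P_def
      by (intro eventually_conj eventually_ball_finite ballI ev S_lim BS_lim
          norm_B_iter_tendsto_0 S finite_lessThan)
    then show "\<exists>k. P m j k"
      by (rule eventually_happens'[rotated]) simp
  qed
  then obtain m where m: "\<And>j. P m j (m j)" by blast
  define f where "f j = S (m j) j" for j
  have fX: "f j \<in> X" for j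
    by (simp add: f_def SX)
  have small: "N (f j) \<le> (1/4) ^ j" for j
    using m[of j] by (simp add: P_def f_def less_imp_le)
  have sm: "summable (\<lambda>j. N (f j))"
    by (rule summable_comparison_test'[of "\<lambda>j. (1/4) ^ j"])
      (use small Lq_norm_nonneg in auto)
  define x where "x v = (\<Sum>j. f j v)" for v
  have x_sums: "(\<lambda>j. f j v) sums x v" for v
    unfolding x_def by (intro summable_sums Lq_summable_pointwise fX sm)
  have xX: "x \<in> X"
    by (rule Lq_sums(1)[OF fX small _ x_sums]) simp
  have close: "N (\<lambda>v. (B ^^ n (m j)) x v - y j v) \<le> 2 * (1/2) ^ j" for j
  proof -
    \<comment> \<open>Dropping the diagonal term \<open>i = j\<close>, which equals
      \<open>y j\<close>, leaves the cross terms as the error.\<close>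
    define h where "h i v = (if i = j then 0 else (B ^^ n (m j)) (f i) v)" for i v
    have hX: "h i \<in> X" for i
      using B_iter_in_Lq[OF fX[of i], of "n (m j)"] Lq_zero
      by (cases "i = j") (auto simp: h_def[abs_def])
    \<comment> \<open>The bound comes from whichever of the stages \<open>i\<close> and
      \<open>j\<close> is later.\<close>
    have cross: "N (h i) \<le> (1/4) ^ max i j" for i
    proof (cases i j rule: linorder_cases)
      case less
      then show ?thesis
        using m[of j] by (auto simp: P_def f_def h_def[abs_def] max_def less_imp_le)
    next
      case greater
      then show ?thesis
        using m[of i] by (auto simp: P_def f_def h_def[abs_def] max_def less_imp_le)
    next
      case equal
      then show ?thesis by (simp add: h_def[abs_def] Lq_zero)
    qed
    \<comment> \<open>As \<open>2 * max i j\<close> is at least \<open>i + j\<close>, the bound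
      splits into a factor that is summable in \<open>i\<close> and one that decays in
      \<open>j\<close>.\<close>
    have le: "N (h i) \<le> (1/2) ^ j * (1/2) ^ i" for i
    proof -
      have "(1/4 :: real) ^ max i j = (1/2) ^ (2 * max i j)"
        by (simp add: power_mult power2_eq_square)
      also have "\<dots> \<le> (1/2) ^ (j + i)"
        by (intro power_decreasing) auto
      finally show ?thesis using cross[of i] by (simp add: power_add)
    qed
    \<comment> \<open>At each vertex the iterate is a finite sum of coordinates, so it commutes with
      the pointwise series for \<open>x\<close>.\<close>
    have "(\<lambda>i. h i v) sums ((B ^^ n (m j)) x v - y j v)" for v
    proof -
      have "(\<lambda>i. (B ^^ n (m j)) (f i) v) sums (B ^^ n (m j)) x v"
        using sums_sum[of "Chi_iter V E (n (m j)) v" "\<lambda>u i. f i u", OF x_sums]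
        by (simp add: backward_shift_iter Lq_zero_outside[OF fX] Lq_zero_outside[OF xX])
      moreover have "(\<lambda>i. if i = j then y j v else 0) sums y j v"
        by (rule sums_single)
      moreover have "(B ^^ n (m j)) (f j) v = y j v"
        unfolding f_def S_def by (subst backward_shift_spread) (simp_all add: y_out)
      ultimately show ?thesis
        by (auto intro!: sums_cong[THEN iffD1, OF _ sums_diff] simp: h_def)
    qed
    from Lq_sums(2)[OF hX le _ this]
    have "N (\<lambda>v. (B ^^ n (m j)) x v - y j v) \<le> (\<Sum>i. (1/2) ^ j * (1/2) ^ i)"
      by (simp add: summable_mult)
    also have "\<dots> = 2 * (1/2) ^ j"
      by (simp add: suminf_mult suminf_geometric)
    finally show ?thesis .
  qed
  have "\<exists>z\<in>range (\<lambda>p. (B ^^ p) x). z \<in> mball g r" if g: "g \<in> X" and r: "r > 0" for g r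
  proof -
    obtain i where i: "N (\<lambda>v. g v - y0 i v) < r / 2"
      using y0_dense[OF g, of "r / 2"] r by auto
    have "(\<lambda>k. 2 * (1/2) ^ k :: real) \<longlonglongrightarrow> 0"
      by (intro tendsto_mult_right_zero LIMSEQ_power_zero) simp
    then have "\<forall>\<^sub>F k in sequentially. 2 * (1/2) ^ k < r / 2"
      by (rule order_tendstoD) (use r in simp)
    then obtain k where k: "2 * (1/2) ^ k < r / 2"
      by (metis eventually_happens' trivial_limit_sequentially)
    \<comment> \<open>This index decodes to \<open>i\<close> and is at least \<open>k\<close>, so
      \<open>y j\<close> is the chosen approximant and the error from \<open>close\<close> is below
      \<open>r / 2\<close>.\<close>
    define j where "j = prod_encode (i, k)"
    have yj: "y j = y0 i" by (simp add: y_def j_def)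
    have "(1/2 :: real) ^ j \<le> (1/2) ^ k"
      unfolding j_def by (intro power_decreasing le_prod_encode_2) auto
    then have 1: "Lq_dist V lam q ((B ^^ n (m j)) x) (y j) < r / 2"
      unfolding Lq_dist_def using close[of j] k by linarith
    have 2: "Lq_dist V lam q g (y j) < r / 2"
      unfolding Lq_dist_def yj using i .
    have "Lq_dist V lam q g ((B ^^ n (m j)) x) < r"
      using triangle[OF g yX B_iter_in_Lq[OF xX], of "n (m j)" j]
        commute[of "y j" "(B ^^ n (m j)) x"] 1 2 by linarith
    then show ?thesis using g B_iter_in_Lq[OF xX] by auto
  qed
  then have "mtopology closure_of range (\<lambda>p. (B ^^ p) x) = X"
    unfolding metric_closure_of by blast
  with xX show ?thesis
    unfolding hypercyclic_on_def by blast
qed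

end

theorem theorem6p1:
  fixes V :: "'v set" and E :: "('v \<times> 'v) set"
    and lam :: "'v \<Rightarrow> real" and q :: real
  assumes "directed_tree V E" and "leafless V E" and "rootless V E"
    and "\<forall>v\<in>V. lam v > 0"
    and "1 \<le> q"
    and "bounded_operator_on (Lq V lam q) (Lq_norm V lam q) (backward_shift V E)"
    and "\<exists>n :: nat \<Rightarrow> nat. strict_mono n \<and> (\<forall>k. n k \<ge> 1) \<and>
           (\<forall>u\<in>V. (\<lambda>k. \<Theta> V E lam q u (n k)) \<longlonglongrightarrow> 0 \<and>
                   (\<lambda>k. \<Omega> V E lam q u (n k)) \<longlonglongrightarrow> 0)"
  shows "hypercyclic_on (Lq V lam q) (Lq_dist V lam q) (backward_shift V E)"
proof -
  obtain n where n: "\<forall>u\<in>V. (\<lambda>k. \<Theta> V E lam q u (n k)) \<longlonglongrightarrow> 0 \<and>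
      (\<lambda>k. \<Omega> V E lam q u (n k)) \<longlonglongrightarrow> 0"
    using assms(7) by blast
  interpret bounded_shift V E lam q n
    using assms(1-6) n by unfold_locales auto
  show ?thesis by (rule hypercyclic_on_Lq)
qed

end
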